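(* For every integer $k\ge 1$ and real number $\varepsilon>0$, there exists a quasi-bipartite graph with $k$ terminals such that every quality-$(1+\varepsilon)$ contraction-based cut sparsifier of it must contain $k^{\tilde\Omega(1/\varepsilon)}$ vertices.
   Context: Graphs are undirected with positive edge weights (capacities, parallel edges allowed); $T\subseteq V(G)$ is the terminal set, $|T|=k$. A graph is quasi-bipartite if every edge is incident to some terminal. For a partition $(T_1,T_2)$ of $T$ into non-empty subsets, $\mathrm{mincut}_G(T_1,T_2)$ is the minimum total weight of an edge set whose removal disconnects $T_1$ from $T_2$. A contraction-based sparsifier $H$ of $G$ with respect to $T$ is obtained from a partition $\mathcal L$ of $V(G)$ in which distinct terminals lie in distinct parts, by contracting each part into a single vertex, keeping parallel edges and discarding self-loops (so $\mathrm{mincut}_H\ge \mathrm{mincut}_G$ for every terminal partition). It has quality $q$ if $\mathrm{mincut}_G(T_1,T_2)\le\mathrm{mincut}_H(T_1,T_2)\le q\cdot \mathrm{mincut}_G(T_1,T_2)$ for every partition $(T_1,T_2)$ of $T$ into non-empty subsets. $\tilde\Omega$ hides polylogarithmic factors in $1/\varepsilon$.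
   Formalization: The exponent is Ω̃(min(1/ε, k)) instead of Ω̃(1/ε): without the cap the claim fails, e.g. for k = 2 contracting the two sides of a minimum cut gives quality 1 with 2 vertices for every ε; for 1/ε ≤ k the bound is as stated. *)

theory Defs
  imports Complex_Main "HOL-Library.Disjoint_Sets"
begin

text \<open>Undirected multigraphs with positive edge weights. Edges are abstract identifiers,
  so that parallel edges are possible and survive contraction; \<open>ends e\<close> is the unordered pair
  of endpoints of \<open>e\<close>.\<close>

record ('v, 'e) wgraph =
  verts :: "'v set"
  edges :: "'e set"
  ends :: "'e \<Rightarrow> 'v set"
  weight :: "'e \<Rightarrow> real"

definition wf_wgraph :: "('v, 'e) wgraph \<Rightarrow> bool" where
  "wf_wgraph G \<longleftrightarrow> finite (verts G) \<and> finite (edges G) \<and>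
     (\<forall>e\<in>edges G. ends G e \<subseteq> verts G \<and> card (ends G e) = 2 \<and> weight G e > 0)"

definition quasi_bipartite :: "('v, 'e) wgraph \<Rightarrow> 'v set \<Rightarrow> bool" where
  "quasi_bipartite G T \<longleftrightarrow> (\<forall>e\<in>edges G. ends G e \<inter> T \<noteq> {})"

definition adj_avoiding :: "('v, 'e) wgraph \<Rightarrow> 'e set \<Rightarrow> ('v \<times> 'v) set" where
  "adj_avoiding G F = {(u, v). \<exists>e\<in>edges G - F. ends G e = {u, v}}"

definition disconnects :: "('v, 'e) wgraph \<Rightarrow> 'e set \<Rightarrow> 'v set \<Rightarrow> 'v set \<Rightarrow> bool" where
  "disconnects G F A B \<longleftrightarrow> F \<subseteq> edges G \<and> (\<forall>a\<in>A. \<forall>b\<in>B. (a, b) \<notin> (adj_avoiding G F)\<^sup>*)"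

definition mincut :: "('v, 'e) wgraph \<Rightarrow> 'v set \<Rightarrow> 'v set \<Rightarrow> real" where
  "mincut G A B = Min {(\<Sum>e\<in>F. weight G e) | F. disconnects G F A B}"

text \<open>The members of \<open>L\<close> meeting \<open>S\<close>. If \<open>L\<close> partitions the vertex set, this is the image of
  \<open>S\<close> under the contraction map sending each vertex to its part.\<close>

definition parts_meeting :: "'v set set \<Rightarrow> 'v set \<Rightarrow> 'v set set" where
  "parts_meeting L S = {X \<in> L. X \<inter> S \<noteq> {}}"

text \<open>The vertices of the contracted graph are the parts themselves. An edge with both ends
  in one part would become a self-loop and is dropped; all other edges keep their identity and
  weight.\<close>

definition contract :: "('v, 'e) wgraph \<Rightarrow> 'v set set \<Rightarrow> ('v set, 'e) wgraph" where
  "contract G L =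
     \<lparr>verts = L,
      edges = {e \<in> edges G. \<not> (\<exists>X\<in>L. ends G e \<subseteq> X)},
      ends = (\<lambda>e. parts_meeting L (ends G e)),
      weight = weight G\<rparr>"

definition contraction_partition :: "('v, 'e) wgraph \<Rightarrow> 'v set \<Rightarrow> 'v set set \<Rightarrow> bool" where
  "contraction_partition G T L \<longleftrightarrow> partition_on (verts G) L \<and>
     (\<forall>X\<in>L. \<forall>s\<in>T \<inter> X. \<forall>t\<in>T \<inter> X. s = t)"

text \<open>Contraction-based cut sparsifiers of quality \<open>q\<close>. A set \<open>S\<close> of terminals of \<open>G\<close> is
  represented in the contracted graph by \<open>parts_meeting L S\<close>.\<close>

definition contraction_sparsifier ::
  "real \<Rightarrow> ('v, 'e) wgraph \<Rightarrow> 'v set \<Rightarrow> ('v set, 'e) wgraph \<Rightarrow> bool" where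
  "contraction_sparsifier q G T H \<longleftrightarrow>
     (\<exists>L. contraction_partition G T L \<and> H = contract G L \<and>
        (\<forall>T1 T2. T1 \<union> T2 = T \<and> T1 \<inter> T2 = {} \<and> T1 \<noteq> {} \<and> T2 \<noteq> {} \<longrightarrow>
           mincut G T1 T2 \<le> mincut H (parts_meeting L T1) (parts_meeting L T2) \<and>
           mincut H (parts_meeting L T1) (parts_meeting L T2) \<le> q * mincut G T1 T2))"

text \<open>Lower bounds up to a constant and polylogarithmic factors, uniformly for all \<open>x > 0\<close>
  (to be used with \<open>x = 1 / \<epsilon>\<close>). The summand \<open>exp 1\<close> only serves to keep the logarithm at
  least 1 when \<open>x\<close> is small.\<close>

definition tilde_Omega :: "(real \<Rightarrow> real) \<Rightarrow> (real \<Rightarrow> real) set" where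
  "tilde_Omega g = {f. \<exists>c>0. \<exists>p::nat. \<forall>x>0. f x \<ge> c * g x / ln (exp 1 + x) ^ p}"

text \<open>The exponent of the lower bound: \<open>1 / \<epsilon>\<close>, capped at the number \<open>k\<close> of terminals. In the
  regime \<open>1 / \<epsilon> \<le> k\<close> this is just \<open>1 / \<epsilon>\<close>. Without a cap no bound of the form
  \<open>k powr f (1 / \<epsilon>)\<close> with \<open>f \<in> tilde_Omega (\<lambda>x. x)\<close> can hold for all \<open>k\<close> and \<open>\<epsilon>\<close>: for
  \<open>k = 2\<close>, contracting the two sides of a minimum cut gives a sparsifier of quality 1 with two
  vertices, however small \<open>\<epsilon>\<close> is. The cap \<open>k\<close> is optimal up to logarithmic factors, since every
  quasi-bipartite graph has a contraction-based sparsifier of quality \<open>1 + \<epsilon>\<close> with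
  \<open>(k / \<epsilon>) powr O(k)\<close> vertices for \<open>\<epsilon> \<le> 1 / 2\<close>, \<open>k \<ge> 2\<close>: contract each vertex carrying at least
  half of its weight towards one terminal into that terminal, and merge the remaining vertices
  whose normalised weight vectors agree up to an additive error of order \<open>\<epsilon> / k\<close>.\<close>

definition inv_eps_capped :: "nat \<Rightarrow> real \<Rightarrow> real" where
  "inv_eps_capped k \<epsilon> = min (1 / \<epsilon>) (real k)"

end

theory Submission
  imports Defs "HOL-Library.Nat_Bijection" "HOL-Library.FuncSet"
begin

text \<open>Take one unit star with \<open>r = 16 d\<close> leaves for every word \<open>w \<in> {..<q}\<^sup>r\<close>, with leaves the
  terminals \<open>(i, w i)\<close>, where \<open>d\<close> is of order \<open>min (1 / \<epsilon>) k\<close> and \<open>r q \<le> k\<close>. Colour the terminals with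
  independent random signs, and let \<open>X v\<close> be the sum of the signs on the leaves of \<open>v\<close>. The minimum
  cut of the graph is the sum of \<open>(r - \<bar>X v\<bar>) / 2\<close>, whereas a part \<open>P\<close> of a contraction pays at least
  \<open>(r \<bar>P\<bar> - \<bar>\<Sum>v\<in>P. X v\<bar>) / 2\<close>. By Khinchine \<open>\<bar>X v\<bar>\<close> has mean at least \<open>20/9 \<cdot> \<surd>d\<close>. Most pairs of
  words agree in few places, so in a part containing many words the \<open>X v\<close> are nearly uncorrelated
  and the mean of \<open>\<bar>\<Sum>v\<in>P. X v\<bar>\<close> is at most \<open>17/12 \<cdot> \<surd>d \<bar>P\<bar>\<close>. If there are few parts, then most words
  lie in such large parts, and for some colouring the loss exceeds \<open>\<epsilon>\<close> times the minimum cut.\<close>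

section \<open>Moments of random signed sums\<close>

text \<open>A colouring is the subset \<open>A\<close> of terminals coloured 1, so expectations over
  independent uniform signs are sums over \<open>Pow T\<close> divided by \<open>2 ^ card T\<close>.
  With a vertex set \<open>U\<close> in place of \<open>A\<close>, the same function tells the side
  of a cut.\<close>

definition sg :: "'a set \<Rightarrow> 'a \<Rightarrow> real" where
  "sg A t = (if t \<in> A then 1 else -1)"

lemma sg_square [simp]: "(sg A t)\<^sup>2 = 1"
  by (simp add: sg_def)

lemma abs_sg [simp]: "\<bar>sg A t\<bar> = 1"
  by (auto simp: sg_def)

text \<open>Toggling the membership of \<open>t\<close> is an involution of \<open>Pow T\<close>
  that keeps \<open>f\<close> and negates the sign at \<open>t\<close>.\<close>

lemma sum_Pow_sg_eq_0:
  assumes "finite T" "t \<in> T" and f: "\<And>A. f (insert t A) = f (A - {t})"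
  shows "(\<Sum>A\<in>Pow T. f A * sg A t) = (0::real)"
proof -
  have fA: "f (if t \<in> A then A - {t} else insert t A) = f A" for A
    using f[of A] by (cases "t \<in> A") (simp_all add: insert_absorb)
  have "(\<Sum>A\<in>Pow T. f A * sg A t) = (\<Sum>A\<in>Pow T. - (f A * sg A t))"
    using assms(2)
    by (intro sum.reindex_bij_witness[where i = "\<lambda>A. if t \<in> A then A - {t} else insert t A"
          and j = "\<lambda>A. if t \<in> A then A - {t} else insert t A"])
       (use fA in \<open>auto simp: sg_def\<close>)
  then show ?thesis
    by (simp add: sum_negf)
qed

lemma signed_sum_flip:
  assumes "t \<notin> S"
  shows "(\<Sum>s\<in>S. w s * sg (insert t A) s) = (\<Sum>s\<in>S. w s * sg (A - {t}) s)"
  using assms by (intro sum.cong) (auto simp: sg_def)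

text \<open>Orthogonality of the signs: in the induction, the cross term is linear in the sign of
  the new \<open>t\<close> and averages to zero.\<close>

lemma second_moment:
  assumes "finite T" "S \<subseteq> T"
  shows "(\<Sum>A\<in>Pow T. (\<Sum>t\<in>S. w t * sg A t)\<^sup>2) = 2 ^ card T * (\<Sum>t\<in>S. (w t)\<^sup>2)"
proof -
  have "finite S" using assms finite_subset by blast
  then show ?thesis using assms(2)
  proof induction
    case (insert t S)
    let ?X = "\<lambda>A. \<Sum>t\<in>S. w t * sg A t"
    have z: "(\<Sum>A\<in>Pow T. ?X A * sg A t) = 0"
      using insert assms(1) by (intro sum_Pow_sg_eq_0 signed_sum_flip) auto
    have "(\<Sum>A\<in>Pow T. (w t * sg A t + ?X A)\<^sup>2)
        = (\<Sum>A\<in>Pow T. (w t)\<^sup>2 + (?X A)\<^sup>2 + 2 * w t * (?X A * sg A t))"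
      by (intro sum.cong) (auto simp: power2_sum power_mult_distrib)
    also have "\<dots> = 2 ^ card T * (w t)\<^sup>2 + (\<Sum>A\<in>Pow T. (?X A)\<^sup>2)"
      using assms(1) by (simp add: sum.distrib z card_Pow flip: sum_distrib_left)
    finally show ?case
      using insert by (simp add: algebra_simps)
  qed simp
qed

text \<open>Terms odd in the new sign vanish. What is left falls short of the claimed bound by twice
  the fourth power of the new weight.\<close>

lemma fourth_moment:
  assumes "finite T" "S \<subseteq> T"
  shows "(\<Sum>A\<in>Pow T. (\<Sum>t\<in>S. w t * sg A t) ^ 4) \<le> 2 ^ card T * (3 * (\<Sum>t\<in>S. (w t)\<^sup>2)\<^sup>2)"
proof -
  have "finite S" using assms finite_subset by blast
  then show ?thesis using assms(2)
  proof induction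
    case (insert t S)
    let ?X = "\<lambda>A. \<Sum>t\<in>S. w t * sg A t"
    let ?V = "\<Sum>t\<in>S. (w t)\<^sup>2"
    have z: "(\<Sum>A\<in>Pow T. ?X A * sg A t) = 0"
      using insert assms(1) by (intro sum_Pow_sg_eq_0 signed_sum_flip) auto
    have z3: "(\<Sum>A\<in>Pow T. (?X A) ^ 3 * sg A t) = 0"
      using insert assms(1)
      by (intro sum_Pow_sg_eq_0 arg_cong[where f = "\<lambda>x. x ^ 3"] signed_sum_flip) auto
    have m2: "(\<Sum>A\<in>Pow T. (?X A)\<^sup>2) = 2 ^ card T * ?V"
      using insert assms(1) by (intro second_moment) auto
    have expand: "(w t * sg A t + x) ^ 4 = (w t) ^ 4 + x ^ 4 + 6 * (w t)\<^sup>2 * x\<^sup>2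
        + 4 * (w t) ^ 3 * (x * sg A t) + 4 * w t * (x ^ 3 * sg A t)" for A x
      by (cases "t \<in> A") (simp_all add: sg_def power4_eq_xxxx power3_eq_cube power2_eq_square algebra_simps)
    have "(\<Sum>A\<in>Pow T. (w t * sg A t + ?X A) ^ 4)
        = 2 ^ card T * (w t) ^ 4 + (\<Sum>A\<in>Pow T. (?X A) ^ 4) + 6 * (w t)\<^sup>2 * (2 ^ card T * ?V)"
      using assms(1) by (simp add: expand sum.distrib z z3 m2 card_Pow flip: sum_distrib_left)
    also have "\<dots> \<le> 2 ^ card T * (w t) ^ 4 + 2 ^ card T * (3 * ?V\<^sup>2)
        + 6 * (w t)\<^sup>2 * (2 ^ card T * ?V)"
      using insert by simp
    also have "\<dots> \<le> 2 ^ card T * (3 * ((w t)\<^sup>2 + ?V)\<^sup>2)"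
    proof -
      have "(w t) ^ 4 = ((w t)\<^sup>2)\<^sup>2" by simp
      then have "(w t) ^ 4 + 3 * ?V\<^sup>2 + 6 * (w t)\<^sup>2 * ?V \<le> 3 * ((w t)\<^sup>2 + ?V)\<^sup>2"
        by (simp add: power2_sum)
      from mult_left_mono[OF this, of "2 ^ card T"] show ?thesis
        by (simp add: algebra_simps)
    qed
    finally show ?case
      using insert by simp
  qed simp
qed

text \<open>Khinchine's inequality, from \<open>\<bar>y\<bar> \<ge> (3 y\<^sup>2 - y ^ 4) / 2\<close> at \<open>y = x / (6 a)\<close>.\<close>

lemma first_moment_ge:
  assumes "finite T" "S \<subseteq> T" and V: "(\<Sum>t\<in>S. (w t)\<^sup>2) = 16 * a\<^sup>2" and a: "a > 0"
  shows "(\<Sum>A\<in>Pow T. \<bar>\<Sum>t\<in>S. w t * sg A t\<bar>) \<ge> 2 ^ card T * (20 / 9 * a)"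
proof -
  let ?X = "\<lambda>A. \<Sum>t\<in>S. w t * sg A t"
  have pt: "\<bar>x\<bar> \<ge> x\<^sup>2 / (4 * a) - x ^ 4 / (432 * a ^ 3)" for x :: real
  proof -
    define y where "y = \<bar>x\<bar> / (6 * a)"
    have y: "y \<ge> 0" using a by (simp add: y_def)
    \<comment> \<open>The quartic has a double root at 1, so the pointwise bound is tight at
      \<open>\<bar>x\<bar> = 6 * a\<close>.\<close>
    have "0 \<le> y * ((y - 1)\<^sup>2 * (y + 2))" using y by simp
    also have "\<dots> = y ^ 4 - 3 * y\<^sup>2 + 2 * y"
      by (simp add: power2_eq_square power4_eq_xxxx algebra_simps)
    finally have "3 * a * (3 * y\<^sup>2 - y ^ 4) \<le> 3 * a * (2 * y)"
      using a by (intro mult_left_mono) auto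
    moreover have x: "\<bar>x\<bar> = 6 * a * y" using a by (simp add: y_def)
    moreover have "x\<^sup>2 / (4 * a) = 9 * a * y\<^sup>2"
    proof -
      have "x\<^sup>2 = (6 * a * y)\<^sup>2" using x by (metis power2_abs)
      then show ?thesis using a by (simp add: power2_eq_square)
    qed
    moreover have "x ^ 4 / (432 * a ^ 3) = 3 * a * y ^ 4"
    proof -
      have "x ^ 4 = (6 * a * y) ^ 4" using x by (metis power_even_abs even_numeral)
      then show ?thesis using a by (simp add: power3_eq_cube power4_eq_xxxx)
    qed
    ultimately show ?thesis by (simp add: algebra_simps)
  qed
  \<comment> \<open>The two moments contribute \<open>4 * a\<close> and \<open>16 / 9 * a\<close>,
    whose difference is \<open>20 / 9 * a\<close>.\<close>
  have "2 ^ card T * (20 / 9 * a)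
      = 2 ^ card T * (16 * a\<^sup>2) / (4 * a) - 2 ^ card T * (3 * (16 * a\<^sup>2)\<^sup>2) / (432 * a ^ 3)"
    using a by (simp add: field_simps power2_eq_square power3_eq_cube)
  also have "\<dots> \<le> (\<Sum>A\<in>Pow T. (?X A)\<^sup>2) / (4 * a) - (\<Sum>A\<in>Pow T. (?X A) ^ 4) / (432 * a ^ 3)"
    using second_moment[OF assms(1,2), of w] fourth_moment[OF assms(1,2), of w] a V
    by (intro diff_mono divide_right_mono) auto
  also have "\<dots> = (\<Sum>A\<in>Pow T. (?X A)\<^sup>2 / (4 * a) - (?X A) ^ 4 / (432 * a ^ 3))"
    by (simp add: sum_subtractf sum_divide_distrib)
  also have "\<dots> \<le> (\<Sum>A\<in>Pow T. \<bar>?X A\<bar>)"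
    by (intro sum_mono pt)
  finally show ?thesis .
qed

text \<open>By AM-GM, \<open>\<bar>x\<bar> \<le> (x\<^sup>2 / c + c) / 2\<close> for \<open>c = 3 b / 2\<close>.\<close>

lemma first_moment_le:
  assumes "finite T" "S \<subseteq> T" and V: "(\<Sum>t\<in>S. (w t)\<^sup>2) \<le> 2 * b\<^sup>2" and b: "b > 0"
  shows "(\<Sum>A\<in>Pow T. \<bar>\<Sum>t\<in>S. w t * sg A t\<bar>) \<le> 2 ^ card T * (17 / 12 * b)"
proof -
  let ?X = "\<lambda>A. \<Sum>t\<in>S. w t * sg A t"
  have pt: "\<bar>x\<bar> \<le> x\<^sup>2 / (3 * b) + 3 / 4 * b" for x :: real
  proof -
    have "0 \<le> (\<bar>x\<bar> - 3 / 2 * b)\<^sup>2" by simp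
    then have "3 * b * \<bar>x\<bar> \<le> x\<^sup>2 + 9 / 4 * (b * b)"
      by (simp add: power2_diff power_mult_distrib power2_eq_square algebra_simps)
    then show ?thesis using b by (simp add: field_simps)
  qed
  have "(\<Sum>A\<in>Pow T. \<bar>?X A\<bar>) \<le> (\<Sum>A\<in>Pow T. (?X A)\<^sup>2 / (3 * b) + 3 / 4 * b)"
    by (intro sum_mono pt)
  also have "\<dots> = 2 ^ card T * ((\<Sum>t\<in>S. (w t)\<^sup>2) / (3 * b) + 3 / 4 * b)"
    using second_moment[OF assms(1,2), of w] assms(1)
    by (simp add: sum.distrib card_Pow algebra_simps flip: sum_divide_distrib)
  also have "\<dots> \<le> 2 ^ card T * (2 * b\<^sup>2 / (3 * b) + 3 / 4 * b)"
    using V b by (intro mult_left_mono add_right_mono divide_right_mono) auto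
  also have "\<dots> = 2 ^ card T * (17 / 12 * b)"
    using b by (simp add: field_simps power2_eq_square)
  finally show ?thesis .
qed

section \<open>Minimum cuts and vertex sets\<close>

definition crossing :: "('v, 'e) wgraph \<Rightarrow> 'v set \<Rightarrow> 'e set" where
  "crossing G U = {e \<in> edges G. ends G e \<inter> U \<noteq> {} \<and> \<not> ends G e \<subseteq> U}"

lemma finite_cut_values:
  "finite (edges G) \<Longrightarrow> finite {(\<Sum>e\<in>F. weight G e) | F. disconnects G F A B}"
  by (rule finite_subset[of _ "(\<lambda>F. \<Sum>e\<in>F. weight G e) ` Pow (edges G)"])
     (auto simp: disconnects_def)

text \<open>A walk that starts in \<open>U\<close> and uses no crossing edge never leaves
  \<open>U\<close>.\<close>

lemma mincut_le_crossing:
  assumes "finite (edges G)" "A \<subseteq> U" "B \<inter> U = {}"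
  shows "mincut G A B \<le> (\<Sum>e\<in>crossing G U. weight G e)"
proof -
  have stay: "v \<in> U" if "(u, v) \<in> (adj_avoiding G (crossing G U))\<^sup>*" "u \<in> U" for u v
    using that by induction (auto simp: adj_avoiding_def crossing_def)
  have "disconnects G (crossing G U) A B"
    using stay assms(2,3) unfolding disconnects_def crossing_def by blast
  then show ?thesis
    unfolding mincut_def using finite_cut_values[OF assms(1)] by (intro Min_le) auto
qed

text \<open>Pulls an optimal cut of the contracted graph back to \<open>G\<close>: the parts
  reachable from \<open>T1\<close> after deleting it form a vertex set \<open>U\<close> that splits
  no part, and all edges of \<open>G\<close> leaving \<open>U\<close> belong to the cut.\<close>

lemma mincut_contract_ge_crossing:
  assumes wf: "wf_wgraph G" and cp: "contraction_partition G T L"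
    and T: "T1 \<union> T2 = T" "T1 \<inter> T2 = {}" "T \<subseteq> verts G"
  obtains U where "T1 \<subseteq> U" "T2 \<inter> U = {}" "\<And>X. X \<in> L \<Longrightarrow> X \<subseteq> U \<or> X \<inter> U = {}"
    "(\<Sum>e\<in>crossing G U. weight G e)
       \<le> mincut (contract G L) (parts_meeting L T1) (parts_meeting L T2)"
proof -
  let ?H = "contract G L" and ?A = "parts_meeting L T1" and ?B = "parts_meeting L T2"
  have part: "partition_on (verts G) L" and
    sep: "\<And>X s t. X \<in> L \<Longrightarrow> s \<in> T \<inter> X \<Longrightarrow> t \<in> T \<inter> X \<Longrightarrow> s = t"
    using cp by (auto simp: contraction_partition_def)
  have cover: "\<Union>L = verts G" and disj: "\<And>X Y v. X \<in> L \<Longrightarrow> Y \<in> L \<Longrightarrow> v \<in> X \<Longrightarrow> v \<in> Y \<Longrightarrow> X = Y"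
    using part by (auto simp: partition_on_def disjoint_def)
  have fin: "finite (edges G)" "finite (edges ?H)"
    using wf by (auto simp: wf_wgraph_def contract_def)
  have AB: "?A \<inter> ?B = {}"
  proof (rule equals0I)
    fix X assume "X \<in> ?A \<inter> ?B"
    then obtain s t where "X \<in> L" "s \<in> X" "s \<in> T1" "t \<in> X" "t \<in> T2"
      by (auto simp: parts_meeting_def)
    with sep[of X s t] T show False by auto
  qed
  \<comment> \<open>Deleting every edge is an admissible cut because no part meets both sides, so
    the minimum is attained by some \<open>F\<close>.\<close>
  have "adj_avoiding ?H (edges ?H) = {}"
    by (auto simp: adj_avoiding_def)
  then have "disconnects ?H (edges ?H) ?A ?B"
    using AB by (auto simp: disconnects_def)
  then have "mincut ?H ?A ?B \<in> {(\<Sum>e\<in>F. weight ?H e) | F. disconnects ?H F ?A ?B}"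
    unfolding mincut_def by (intro Min_in finite_cut_values fin) blast
  then obtain F where F: "disconnects ?H F ?A ?B" "mincut ?H ?A ?B = (\<Sum>e\<in>F. weight ?H e)"
    by blast
  define R where "R = {X \<in> L. \<exists>Y\<in>?A. (Y, X) \<in> (adj_avoiding ?H F)\<^sup>*}"
  have RB: "R \<inter> ?B = {}"
    using F(1) by (auto simp: R_def disconnects_def)
  have RL: "R \<subseteq> L" by (auto simp: R_def)
  have AR: "?A \<subseteq> R" by (auto simp: R_def parts_meeting_def)
  \<comment> \<open>An edge leaving the union joins a part \<open>X\<close> in \<open>R\<close> to a
    part \<open>Y\<close> outside \<open>R\<close>. It survives the contraction, and if it were not
    in \<open>F\<close> then \<open>Y\<close> would be reachable too.\<close>
  have sub: "crossing G (\<Union>R) \<subseteq> F"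
  proof
    fix e assume e: "e \<in> crossing G (\<Union>R)"
    then have eG: "e \<in> edges G" by (simp add: crossing_def)
    have "card (ends G e) = 2" "ends G e \<subseteq> verts G"
      using wf eG by (auto simp: wf_wgraph_def)
    moreover obtain u v where uv: "u \<in> ends G e" "u \<in> \<Union>R" "v \<in> ends G e" "v \<notin> \<Union>R"
      using e by (auto simp: crossing_def)
    ultimately have ends: "ends G e = {u, v}" "v \<in> verts G"
      by (auto simp: card_2_iff)
    obtain X where X: "X \<in> R" "u \<in> X" using uv by blast
    obtain Y where Y: "Y \<in> L" "v \<in> Y" using ends cover by blast
    have XL: "X \<in> L" using X RL by blast
    have nXY: "v \<notin> X" "Y \<notin> R" using X Y uv by auto
    have eH: "e \<in> edges ?H"
      using eG ends nXY disj[OF XL _ X(2)] by (auto simp: contract_def)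
    have "ends ?H e = {X, Y}"
      using ends X Y XL disj by (auto simp: contract_def parts_meeting_def)
    then have "(X, Y) \<in> adj_avoiding ?H F" if "e \<notin> F"
      using that eH by (auto simp: adj_avoiding_def)
    moreover obtain Z where "Z \<in> ?A" "(Z, X) \<in> (adj_avoiding ?H F)\<^sup>*"
      using X by (auto simp: R_def)
    ultimately show "e \<in> F"
      using nXY Y by (auto simp: R_def intro: rtrancl_into_rtrancl)
  qed
  have pos: "F \<subseteq> edges G" "\<And>e. e \<in> edges G \<Longrightarrow> weight G e \<ge> 0"
    using F(1) wf by (auto simp: disconnects_def contract_def wf_wgraph_def intro: less_imp_le)
  show ?thesis
  proof
    show "T1 \<subseteq> \<Union>R"
    proof
      fix t assume t: "t \<in> T1"
      then obtain X where "X \<in> L" "t \<in> X" using T cover by blast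
      with t AR show "t \<in> \<Union>R" by (auto simp: parts_meeting_def)
    qed
    show "T2 \<inter> \<Union>R = {}"
      using RB RL by (auto simp: parts_meeting_def)
    show "X \<subseteq> \<Union>R \<or> X \<inter> \<Union>R = {}" if "X \<in> L" for X
      using that RL disj by blast
    have "(\<Sum>e\<in>crossing G (\<Union>R). weight G e) \<le> (\<Sum>e\<in>F. weight G e)"
      using sub pos finite_subset[OF pos(1) fin(1)] by (intro sum_mono2) auto
    then show "(\<Sum>e\<in>crossing G (\<Union>R). weight G e) \<le> mincut ?H ?A ?B"
      using F(2) by (simp add: contract_def)
  qed
qed

text \<open>Sending each terminal to its part is injective. This bound settles the case where
  \<open>1 / \<epsilon>\<close> or \<open>k\<close> is small.\<close>

lemma card_contraction_partition_ge:
  assumes "finite (verts G)" "T \<subseteq> verts G" "contraction_partition G T L"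
  shows "card T \<le> card L"
proof -
  have part: "\<Union>L = verts G"
    using assms(3) by (auto simp: contraction_partition_def partition_on_def)
  have "finite L" using part assms(1) finite_UnionD by metis
  moreover have "\<forall>t\<in>T. \<exists>X. X \<in> L \<and> t \<in> X" using part assms(2) by blast
  then obtain p where p: "\<forall>t\<in>T. p t \<in> L \<and> t \<in> p t" by metis
  moreover have "inj_on p T"
    using p assms(3) unfolding contraction_partition_def inj_on_def by (metis IntI)
  ultimately show ?thesis
    by (intro card_inj_on_le[of p]) auto
qed

section \<open>Graphs of unit stars\<close>

text \<open>\<open>V\<close> holds the star centres. The edge from \<open>v\<close> to its leaf
  \<open>t\<close> is named by the code of the pair, which keeps the edges of different stars
  distinct within \<open>nat\<close>.\<close>

definition star_graph :: "nat set \<Rightarrow> nat set \<Rightarrow> (nat \<Rightarrow> nat set) \<Rightarrow> (nat, nat) wgraph" where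
  "star_graph T V S =
     \<lparr>verts = T \<union> V,
      edges = prod_encode ` (SIGMA v:V. S v),
      ends = (\<lambda>e. {fst (prod_decode e), snd (prod_decode e)}),
      weight = (\<lambda>_. 1)\<rparr>"

locale stars =
  fixes T V :: "nat set" and S :: "nat \<Rightarrow> nat set" and r :: nat
  assumes fin: "finite T" "finite V" and disj: "T \<inter> V = {}"
    and S: "\<And>v. v \<in> V \<Longrightarrow> S v \<subseteq> T" "\<And>v. v \<in> V \<Longrightarrow> card (S v) = r"
begin

abbreviation "G \<equiv> star_graph T V S"

lemma finite_S: "v \<in> V \<Longrightarrow> finite (S v)"
  using S fin finite_subset by blast

lemma wf_G: "wf_wgraph G"
  using fin disj S finite_S
  by (auto simp: wf_wgraph_def star_graph_def card_2_iff')

lemma quasi_bipartite_G: "quasi_bipartite G T"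
  using S by (fastforce simp: quasi_bipartite_def star_graph_def)

definition X :: "nat set \<Rightarrow> nat \<Rightarrow> real" where
  "X A v = (\<Sum>t\<in>S v. sg A t)"

lemma X_cong: "v \<in> V \<Longrightarrow> A \<inter> T = B \<inter> T \<Longrightarrow> X A v = X B v"
  unfolding X_def using S by (intro sum.cong) (auto simp: sg_def)

text \<open>An edge crosses exactly when its ends have opposite signs, so
  \<open>(1 - sg U v * sg U t) / 2\<close> is its indicator.\<close>

lemma sum_crossing:
  "(\<Sum>e\<in>crossing G U. weight G e) = (\<Sum>v\<in>V. (real r - sg U v * X U v) / 2)"
proof -
  have cr: "crossing G U = prod_encode ` {p \<in> SIGMA v:V. S v. (fst p \<in> U) \<noteq> (snd p \<in> U)}"
    by (auto simp: crossing_def star_graph_def image_iff)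
  have "(\<Sum>e\<in>crossing G U. weight G e)
      = (\<Sum>p\<in>{p \<in> SIGMA v:V. S v. (fst p \<in> U) \<noteq> (snd p \<in> U)}. 1)"
    unfolding cr by (subst sum.reindex) (auto simp: inj_prod_encode star_graph_def)
  also have "\<dots> = (\<Sum>p\<in>(SIGMA v:V. S v). if (fst p \<in> U) \<noteq> (snd p \<in> U) then 1 else 0)"
    using fin finite_S by (intro sum.inter_filter) auto
  also have "\<dots> = (\<Sum>v\<in>V. \<Sum>t\<in>S v. if (v \<in> U) \<noteq> (t \<in> U) then 1 else 0)"
    using fin finite_S by (subst sum.Sigma) (auto simp: case_prod_unfold)
  also have "\<dots> = (\<Sum>v\<in>V. \<Sum>t\<in>S v. (1 - sg U v * sg U t) / 2)"
    by (intro sum.cong) (auto simp: sg_def)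
  also have "\<dots> = (\<Sum>v\<in>V. (real r - sg U v * X U v) / 2)"
    using S(2)
    by (intro sum.cong)
       (auto simp: X_def sum_subtractf simp flip: sum_divide_distrib sum_distrib_left)
  finally show ?thesis .
qed

text \<open>Each centre joins the side of the majority of its leaves.\<close>

lemma mincut_G_le:
  assumes "A \<subseteq> T"
  shows "mincut G A (T - A) \<le> (\<Sum>v\<in>V. (real r - \<bar>X A v\<bar>) / 2)"
proof -
  define U where "U = A \<union> {v \<in> V. X A v \<ge> 0}"
  have "mincut G A (T - A) \<le> (\<Sum>e\<in>crossing G U. weight G e)"
    using wf_G disj by (intro mincut_le_crossing) (auto simp: U_def wf_wgraph_def)
  also have "\<dots> = (\<Sum>v\<in>V. (real r - \<bar>X A v\<bar>) / 2)"
    unfolding sum_crossing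
  proof (intro sum.cong refl)
    fix v assume v: "v \<in> V"
    have "X U v = X A v"
      using assms disj by (intro X_cong v) (auto simp: U_def)
    moreover have "v \<in> U \<longleftrightarrow> X A v \<ge> 0"
      using v assms disj by (auto simp: U_def)
    ultimately show "(real r - sg U v * X U v) / 2 = (real r - \<bar>X A v\<bar>) / 2"
      by (simp add: sg_def)
  qed
  finally show ?thesis .
qed

lemma sum_parts:
  assumes "contraction_partition G T L"
  shows "(\<Sum>v\<in>V. h v) = (\<Sum>P\<in>L. \<Sum>v\<in>P \<inter> V. h v)"
proof -
  have part: "partition_on (T \<union> V) L"
    using assms by (auto simp: contraction_partition_def star_graph_def)
  then have L: "\<Union>L = T \<union> V" by (simp add: partition_on_def)
  then have "finite L" using fin by (metis finite_UnI finite_UnionD)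
  have "V = (\<Union>P\<in>L. P \<inter> V)" using L by auto
  then have "(\<Sum>v\<in>V. h v) = (\<Sum>v\<in>(\<Union>P\<in>L. P \<inter> V). h v)" by simp
  also have "\<dots> = (\<Sum>P\<in>L. \<Sum>v\<in>P \<inter> V. h v)"
    using \<open>finite L\<close> part fin
    by (intro sum.UNION_disjoint) (auto simp: partition_on_def disjoint_def)
  finally show ?thesis .
qed

text \<open>A part is charged at least as much as if it could choose its side freely, whether or not
  it contains a terminal.\<close>

lemma mincut_contract_ge:
  assumes cp: "contraction_partition G T L" and "A \<subseteq> T"
  shows "(real (card V * r) - (\<Sum>P\<in>L. \<bar>\<Sum>v\<in>P \<inter> V. X A v\<bar>)) / 2
    \<le> mincut (contract G L) (parts_meeting L A) (parts_meeting L (T - A))"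
proof -
  obtain U where U: "A \<subseteq> U" "(T - A) \<inter> U = {}" "\<And>P. P \<in> L \<Longrightarrow> P \<subseteq> U \<or> P \<inter> U = {}"
    "(\<Sum>e\<in>crossing G U. weight G e)
       \<le> mincut (contract G L) (parts_meeting L A) (parts_meeting L (T - A))"
    using assms by (elim mincut_contract_ge_crossing[OF wf_G, of T L A "T - A"])
      (auto simp: star_graph_def)
  have XU: "X U v = X A v" if "v \<in> V" for v
    using U assms that by (intro X_cong) auto
  have "(\<Sum>v\<in>V. sg U v * X U v) = (\<Sum>P\<in>L. \<Sum>v\<in>P \<inter> V. sg U v * X U v)"
    by (rule sum_parts[OF cp])
  also have "\<dots> \<le> (\<Sum>P\<in>L. \<bar>\<Sum>v\<in>P \<inter> V. X A v\<bar>)"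
  proof (intro sum_mono)
    fix P assume "P \<in> L"
    \<comment> \<open>\<open>U\<close> does not split \<open>P\<close>, so all centres in
      \<open>P\<close> share one sign.\<close>
    with U(3) obtain s :: real where s: "\<bar>s\<bar> = 1" "\<And>v. v \<in> P \<Longrightarrow> sg U v = s"
      by (metis IntI abs_sg empty_iff sg_def subsetD)
    have "(\<Sum>v\<in>P \<inter> V. sg U v * X U v) = s * (\<Sum>v\<in>P \<inter> V. X A v)"
      using s XU by (simp add: sum_distrib_left)
    also have "\<dots> \<le> \<bar>\<Sum>v\<in>P \<inter> V. X A v\<bar>"
      using s(1) by (metis abs_ge_self abs_mult mult_1)
    finally show "(\<Sum>v\<in>P \<inter> V. sg U v * X U v) \<le> \<bar>\<Sum>v\<in>P \<inter> V. X A v\<bar>" .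
  qed
  finally show ?thesis
    using U(4) by (simp add: sum_crossing sum_subtractf flip: sum_divide_distrib)
qed

text \<open>The left side is twice the gap between the two preceding cut bounds: what the centres of
  a part lose by choosing a side jointly instead of individually.\<close>

lemma excess_le:
  assumes cp: "contraction_partition G T L" and "A \<subseteq> T" "\<epsilon> \<ge> 0"
    and q: "\<And>T1 T2. T1 \<union> T2 = T \<Longrightarrow> T1 \<inter> T2 = {} \<Longrightarrow> T1 \<noteq> {} \<Longrightarrow> T2 \<noteq> {} \<Longrightarrow>
      mincut (contract G L) (parts_meeting L T1) (parts_meeting L T2)
        \<le> (1 + \<epsilon>) * mincut G T1 T2"
  shows "(\<Sum>P\<in>L. (\<Sum>v\<in>P \<inter> V. \<bar>X A v\<bar>) - \<bar>\<Sum>v\<in>P \<inter> V. X A v\<bar>) \<le> \<epsilon> * (card V * r)"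
\<comment> \<open>A one-coloured terminal set is no admissible partition, but the later averages run
  over all of \<open>Pow T\<close>. Here all \<open>X A v\<close> are equal, so the loss is
  zero.\<close>
proof (cases "A = {} \<or> A = T")
  case True
  then have "\<exists>s. \<forall>t\<in>T. sg A t = s"
    by (intro exI[of _ "if A = {} then -1 else 1"]) (auto simp: sg_def)
  then obtain s where s: "\<And>t. t \<in> T \<Longrightarrow> sg A t = s"
    by blast
  have Xs: "X A v = s * r" if "v \<in> V" for v
  proof -
    have "X A v = (\<Sum>t\<in>S v. s)"
      unfolding X_def using S(1)[OF that] s by (intro sum.cong) auto
    then show ?thesis using S(2)[OF that] by simp
  qed
  have "(\<Sum>v\<in>P \<inter> V. \<bar>X A v\<bar>) = \<bar>\<Sum>v\<in>P \<inter> V. X A v\<bar>" for P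
    using Xs by (simp add: abs_mult)
  then show ?thesis using \<open>\<epsilon> \<ge> 0\<close> by simp
next
  case False
  let ?N = "\<Sum>v\<in>V. \<bar>X A v\<bar>"
  let ?K = "\<Sum>P\<in>L. \<bar>\<Sum>v\<in>P \<inter> V. X A v\<bar>"
  have "(real (card V * r) - ?K) / 2
      \<le> mincut (contract G L) (parts_meeting L A) (parts_meeting L (T - A))"
    by (rule mincut_contract_ge[OF cp \<open>A \<subseteq> T\<close>])
  also have "\<dots> \<le> (1 + \<epsilon>) * mincut G A (T - A)"
    using False \<open>A \<subseteq> T\<close> by (intro q) auto
  also have "\<dots> \<le> (1 + \<epsilon>) * ((real (card V * r) - ?N) / 2)"
    using mincut_G_le[OF \<open>A \<subseteq> T\<close>] \<open>\<epsilon> \<ge> 0\<close>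
    by (intro mult_left_mono) (auto simp: sum_subtractf simp flip: sum_divide_distrib)
  finally have "?N - ?K \<le> \<epsilon> * (card V * r) - \<epsilon> * ?N"
    by (simp add: field_simps)
  also have "\<dots> \<le> \<epsilon> * (card V * r)"
    using \<open>\<epsilon> \<ge> 0\<close> by (simp add: sum_nonneg)
  finally show ?thesis
    using sum_parts[OF cp, of "\<lambda>v. \<bar>X A v\<bar>"] by (simp add: sum_subtractf)
qed

section \<open>Averages of the star sums over all colourings\<close>

lemma X_eq: "v \<in> V \<Longrightarrow> X A v = (\<Sum>t\<in>T. of_bool (t \<in> S v) * sg A t)"
  unfolding X_def using S(1) fin
  by (intro sum.mono_neutral_cong_left) auto

lemma sum_abs_X_ge:
  assumes "v \<in> V" "real r = 16 * a\<^sup>2" "a > 0"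
  shows "(\<Sum>A\<in>Pow T. \<bar>X A v\<bar>) \<ge> 2 ^ card T * (20 / 9 * a)"
proof -
  have "(\<Sum>t\<in>T. (of_bool (t \<in> S v) :: real)\<^sup>2) = real (card (T \<inter> S v))"
    using fin by (simp add: of_bool_def if_distrib[where f = "\<lambda>x. x\<^sup>2"] sum.If_cases Int_def
        cong: if_cong)
  also have "T \<inter> S v = S v" using S(1)[OF assms(1)] by auto
  finally show ?thesis
    using first_moment_ge[of T T "\<lambda>t. of_bool (t \<in> S v)" a] fin assms S(2)
    by (simp add: X_eq)
qed

text \<open>The weight of \<open>t\<close> is the number of stars of \<open>g\<close> with leaf
  \<open>t\<close>. Double counting turns the sum of squared weights into the sum of
  \<open>card (S u \<inter> S v)\<close> over pairs, so small overlaps give a small second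
  moment.\<close>

lemma sum_abs_group_le:
  fixes a :: real
  assumes "g \<subseteq> V" "g \<noteq> {}" "a > 0"
    and code: "\<And>u. u \<in> g \<Longrightarrow> (\<Sum>v\<in>g. real (card (S u \<inter> S v))) \<le> 2 * a\<^sup>2 * card g"
  shows "(\<Sum>A\<in>Pow T. \<bar>\<Sum>v\<in>g. X A v\<bar>) \<le> 2 ^ card T * (17 / 12 * (a * card g))"
proof -
  let ?w = "\<lambda>t. \<Sum>v\<in>g. of_bool (t \<in> S v) :: real"
  have fg: "finite g" using assms(1) fin finite_subset by blast
  have Xg: "(\<Sum>v\<in>g. X A v) = (\<Sum>t\<in>T. ?w t * sg A t)" for A
  proof -
    have "(\<Sum>v\<in>g. X A v) = (\<Sum>v\<in>g. \<Sum>t\<in>T. of_bool (t \<in> S v) * sg A t)"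
      using assms(1) by (intro sum.cong X_eq) auto
    also have "\<dots> = (\<Sum>t\<in>T. ?w t * sg A t)"
      by (subst sum.swap) (simp add: sum_distrib_right)
    finally show ?thesis .
  qed
  have "(\<Sum>t\<in>T. (?w t)\<^sup>2) = (\<Sum>t\<in>T. \<Sum>u\<in>g. \<Sum>v\<in>g. of_bool (t \<in> S u \<inter> S v))"
    by (simp add: power2_eq_square sum_product of_bool_conj)
  also have "\<dots> = (\<Sum>u\<in>g. \<Sum>v\<in>g. \<Sum>t\<in>T. of_bool (t \<in> S u \<inter> S v))"
    by (subst sum.swap) (rule sum.cong[OF refl], rule sum.swap)
  also have "\<dots> = (\<Sum>u\<in>g. \<Sum>v\<in>g. real (card (S u \<inter> S v)))"
  proof (intro sum.cong refl)
    fix u v assume "u \<in> g" "v \<in> g"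
    then have "T \<inter> {t. t \<in> S u \<inter> S v} = S u \<inter> S v"
      using S(1) assms(1) by blast
    then show "(\<Sum>t\<in>T. of_bool (t \<in> S u \<inter> S v)) = real (card (S u \<inter> S v))"
      using fin by (subst sum_of_bool_eq) simp_all
  qed
  also have "\<dots> \<le> (\<Sum>u\<in>g. 2 * a\<^sup>2 * real (card g))"
    by (intro sum_mono code)
  also have "\<dots> = 2 * (a * card g)\<^sup>2"
    by (simp add: power2_eq_square)
  finally show ?thesis
    unfolding Xg using assms fg fin by (intro first_moment_le) (auto simp: card_gt_0_iff)
qed

text \<open>Averages the loss over all colourings. \<open>B\<close> allows for the stars overlapping
  heavily with \<open>u\<close>; it is dominated by \<open>d * card g\<close> once a part has at
  least \<open>B / d\<close> centres. With too few parts, the total deficit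
  \<open>card L * (B / d)\<close> is at most half of \<open>card V\<close>.\<close>

theorem card_parts_gt:
  fixes B :: real
  assumes cs: "contraction_sparsifier (1 + \<epsilon>) G T H"
    and \<epsilon>: "\<epsilon> \<ge> 0" "40 * \<epsilon> * sqrt d < 1" and d: "d > 0" "r = 16 * d" and "V \<noteq> {}"
    and code: "\<And>u g. u \<in> V \<Longrightarrow> g \<subseteq> V \<Longrightarrow>
      (\<Sum>v\<in>g. real (card (S u \<inter> S v))) \<le> real d * card g + B"
    and B: "B > 0"
  shows "real (card V) * d < 2 * card (verts H) * B"
proof (rule ccontr)
  assume neg: "\<not> real (card V) * d < 2 * card (verts H) * B"
  obtain L where cp: "contraction_partition G T L" and H: "H = contract G L"
    and q0: "\<forall>T1 T2. T1 \<union> T2 = T \<and> T1 \<inter> T2 = {} \<and> T1 \<noteq> {} \<and> T2 \<noteq> {} \<longrightarrow>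
      mincut G T1 T2 \<le> mincut H (parts_meeting L T1) (parts_meeting L T2) \<and>
      mincut H (parts_meeting L T1) (parts_meeting L T2) \<le> (1 + \<epsilon>) * mincut G T1 T2"
    using cs unfolding contraction_sparsifier_def by (elim exE conjE) (rule that)
  have q: "mincut (contract G L) (parts_meeting L T1) (parts_meeting L T2)
        \<le> (1 + \<epsilon>) * mincut G T1 T2"
    if "T1 \<union> T2 = T" "T1 \<inter> T2 = {}" "T1 \<noteq> {}" "T2 \<noteq> {}" for T1 T2
    using q0 that unfolding H by simp
  define a where "a = sqrt d"
  have a: "a > 0" "a\<^sup>2 = d" using d by (auto simp: a_def)
  let ?D = "\<lambda>A P. (\<Sum>v\<in>P \<inter> V. \<bar>X A v\<bar>) - \<bar>\<Sum>v\<in>P \<inter> V. X A v\<bar>"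
  let ?m = "\<lambda>P. real (card (P \<inter> V))"
  \<comment> \<open>The constant: \<open>20 / 9 - 17 / 12 = 29 / 36\<close> exceeds
    \<open>4 / 5\<close>. Subtracting \<open>B / d\<close> makes the claim trivial for small parts,
    where the loss is merely nonnegative, and gives one bound that can be summed over all
    parts.\<close>
  have part: "2 ^ card T * (4 / 5 * a * (?m P - B / d)) \<le> (\<Sum>A\<in>Pow T. ?D A P)" for P
  proof (cases "?m P \<le> B / d")
    case True
    then have "2 ^ card T * (4 / 5 * a * (?m P - B / d)) \<le> 0"
      using a by (simp add: mult_nonneg_nonpos)
    also have "0 \<le> (\<Sum>A\<in>Pow T. ?D A P)"
      by (intro sum_nonneg) (simp add: sum_abs)
    finally show ?thesis .
  next
    case False
    let ?g = "P \<inter> V"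
    have "B / d > 0" using B d by simp
    with False have g: "?g \<noteq> {}" by (intro notI) simp
    define K where "K = 2 ^ card T * (a * ?m P)"
    have "(\<Sum>A\<in>Pow T. \<bar>\<Sum>v\<in>?g. X A v\<bar>) \<le> 2 ^ card T * (17 / 12 * (a * ?m P))"
    proof (rule sum_abs_group_le[OF _ g a(1)])
      fix u assume "u \<in> ?g"
      then have "(\<Sum>v\<in>?g. real (card (S u \<inter> S v))) \<le> real d * ?m P + B"
        by (intro code) auto
      moreover have "B \<le> d * ?m P" using False d by (simp add: field_simps)
      ultimately show "(\<Sum>v\<in>?g. real (card (S u \<inter> S v))) \<le> 2 * a\<^sup>2 * ?m P"
        by (simp add: a)
    qed auto
    then have "(\<Sum>A\<in>Pow T. \<bar>\<Sum>v\<in>?g. X A v\<bar>) \<le> 17 / 12 * K"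
      by (simp add: K_def)
    moreover have "(\<Sum>A\<in>Pow T. \<Sum>v\<in>?g. \<bar>X A v\<bar>) \<ge> (\<Sum>v\<in>?g. 2 ^ card T * (20 / 9 * a))"
      by (subst sum.swap) (intro sum_mono sum_abs_X_ge, use a d in auto)
    then have "(\<Sum>A\<in>Pow T. \<Sum>v\<in>?g. \<bar>X A v\<bar>) \<ge> 20 / 9 * K"
      by (simp add: K_def algebra_simps)
    moreover have "2 ^ card T * (4 / 5 * a * (?m P - B / d)) \<le> 4 / 5 * K"
      using a B d by (simp add: K_def)
    moreover have "K \<ge> 0" using a by (simp add: K_def)
    ultimately show ?thesis
      unfolding sum_subtractf by linarith
  qed
  have mV: "(\<Sum>P\<in>L. ?m P) = card V"
    using sum_parts[OF cp, of "\<lambda>_. 1::real"] by simp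
  then have excess: "(\<Sum>P\<in>L. ?m P - B / d) = card V - card L * (B / d)"
    by (simp add: sum_subtractf)
  have "card L * (B / d) \<le> card V / 2"
    using neg d by (simp add: H contract_def field_simps)
  then have "2 ^ card T * (4 / 5 * a * (card V / 2))
      \<le> 2 ^ card T * (4 / 5 * a * (card V - card L * (B / d)))"
    using a by (intro mult_left_mono) auto
  also have "\<dots> = (\<Sum>P\<in>L. 2 ^ card T * (4 / 5 * a * (?m P - B / d)))"
    by (simp only: excess[symmetric] sum_distrib_left)
  also have "\<dots> \<le> (\<Sum>P\<in>L. \<Sum>A\<in>Pow T. ?D A P)"
    by (intro sum_mono part)
  also have "\<dots> = (\<Sum>A\<in>Pow T. \<Sum>P\<in>L. ?D A P)"
    by (rule sum.swap)
  also have "\<dots> \<le> (\<Sum>A\<in>Pow T. \<epsilon> * (card V * r))"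
    using \<epsilon> by (intro sum_mono excess_le[OF cp _ _ q]) auto
  also have "\<dots> = 2 ^ card T * (\<epsilon> * (card V * r))"
    using fin by (simp add: card_Pow)
  \<comment> \<open>As \<open>r = 16 * a * a\<close>, this compares \<open>2 / 5 * a\<close> with
    \<open>16 * \<epsilon> * a * a\<close> per star, whence the constant 40.\<close>
  finally have "4 / 5 * a * (card V / 2) \<le> \<epsilon> * (card V * r)" by simp
  moreover have "real r = 16 * (a * a)" using d a by (simp add: power2_eq_square)
  ultimately have "card V * (a * 1) \<le> card V * (a * (40 * \<epsilon> * a))"
    by (simp add: algebra_simps)
  moreover have "real (card V) > 0" using \<open>V \<noteq> {}\<close> fin by (simp add: card_gt_0_iff)
  ultimately have "1 \<le> 40 * \<epsilon> * a"
    using a(1) by (metis mult_le_cancel_left_pos)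
  with \<epsilon>(2) show False by (simp add: a_def)
qed

end

section \<open>The star family of all words\<close>

definition agree :: "nat \<Rightarrow> (nat \<Rightarrow> nat) \<Rightarrow> (nat \<Rightarrow> nat) \<Rightarrow> nat set" where
  "agree r f g = {i \<in> {..<r}. f i = g i}"

text \<open>The sum over words factorises over positions. At each position the matching letter
  contributes \<open>q\<close> and every other letter 1, together at most
  \<open>2 * q\<close>.\<close>

lemma sum_power_agree_le:
  assumes "f \<in> {..<r} \<rightarrow>\<^sub>E {..<q}"
  shows "(\<Sum>g\<in>{..<r} \<rightarrow>\<^sub>E {..<q}. real q ^ card (agree r f g)) \<le> (2 * real q) ^ r"
proof -
  have "(\<Sum>g\<in>{..<r} \<rightarrow>\<^sub>E {..<q}. real q ^ card (agree r f g))
      = (\<Sum>g\<in>{..<r} \<rightarrow>\<^sub>E {..<q}. \<Prod>i<r. if g i = f i then real q else 1)"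
  proof (intro sum.cong refl)
    fix g
    have "agree r f g = {..<r} \<inter> {i. g i = f i}" by (auto simp: agree_def)
    then show "real q ^ card (agree r f g) = (\<Prod>i<r. if g i = f i then real q else 1)"
      by (simp add: prod.If_cases)
  qed
  also have "\<dots> = (\<Prod>i<r. \<Sum>y<q. if y = f i then real q else 1)"
    by (subst prod_sum_PiE) auto
  also have "\<dots> \<le> (\<Prod>i<r. 2 * real q)"
  proof (intro prod_mono conjI)
    fix i assume "i \<in> {..<r}"
    have "(\<Sum>y<q. if y = f i then real q else 1) \<le> (\<Sum>y<q. (if y = f i then real q else 0) + 1)"
      by (intro sum_mono) auto
    also have "\<dots> \<le> 2 * real q" by (simp add: sum.distrib)
    finally show "(\<Sum>y<q. if y = f i then real q else 1) \<le> 2 * real q" .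
  qed (auto intro: sum_nonneg)
  finally show ?thesis by simp
qed

text \<open>A Markov-type bound: a number \<open>c > d\<close> of agreements exceeds
  \<open>d\<close> by less than \<open>q ^ (c - d)\<close>, and the exponential moment over all
  words pays for these excesses.\<close>

lemma sum_agree_le:
  assumes "f \<in> {..<r} \<rightarrow>\<^sub>E {..<q}" "W \<subseteq> {..<r} \<rightarrow>\<^sub>E {..<q}" "q \<ge> 2"
  shows "(\<Sum>g\<in>W. real (card (agree r f g))) \<le> real d * card W + (2 * real q) ^ r / real q ^ d"
proof -
  have pt: "real c \<le> d + real q ^ c / real q ^ d" for c
  proof (cases "c \<le> d")
    case False
    have "c - d < q ^ (c - d)" using assms(3) by (intro power_gt_expt) auto
    then have "real (c - d) \<le> real q ^ (c - d)"
      by (metis less_imp_le of_nat_le_iff of_nat_power)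
    with False show ?thesis using assms(3) by (simp add: power_diff of_nat_diff)
  qed (simp add: add_increasing2)
  have "(\<Sum>g\<in>W. real (card (agree r f g)))
      \<le> (\<Sum>g\<in>W. d + real q ^ card (agree r f g) / real q ^ d)"
    by (intro sum_mono pt)
  also have "\<dots> = real d * card W + (\<Sum>g\<in>W. real q ^ card (agree r f g)) / real q ^ d"
    by (simp add: sum.distrib sum_divide_distrib)
  also have "(\<Sum>g\<in>W. real q ^ card (agree r f g))
      \<le> (\<Sum>g\<in>{..<r} \<rightarrow>\<^sub>E {..<q}. real q ^ card (agree r f g))"
    using assms(2) by (intro sum_mono2 finite_PiE) auto
  also have "\<dots> \<le> (2 * real q) ^ r" by (rule sum_power_agree_le[OF assms(1)])
  finally show ?thesis by (simp add: divide_right_mono)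
qed

text \<open>Letter \<open>y\<close> at position \<open>i\<close> becomes terminal
  \<open>i * q + y\<close>, so two stars share as many leaves as their words have agreements.
  Centres are numbered from \<open>k\<close> on to avoid the terminals, and \<open>h\<close> assigns
  them their words.\<close>

lemma exists_star_code:
  assumes "r * q \<le> k" "q \<ge> 2"
  obtains V S where "stars {..<k} V S r" "card V = q ^ r"
    "\<And>u g d. u \<in> V \<Longrightarrow> g \<subseteq> V \<Longrightarrow>
      (\<Sum>v\<in>g. real (card (S u \<inter> S v))) \<le> real d * card g + (2 * real q) ^ r / real q ^ d"
proof -
  let ?W = "{..<r} \<rightarrow>\<^sub>E {..<q}"
  define V where "V = {k..<k + q ^ r}"
  have "finite ?W" by (simp add: finite_PiE)
  moreover have "card ?W = card V" by (simp add: card_PiE V_def)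
  ultimately obtain h where h: "bij_betw h V ?W"
    by (metis V_def finite_atLeastLessThan finite_same_card_bij)
  have hW: "h v \<in> ?W" if "v \<in> V" for v using h that by (auto simp: bij_betw_def)
  have hq: "h v i < q" if "v \<in> V" "i < r" for v i using hW that by fastforce
  define S where "S v = (\<lambda>i. i * q + h v i) ` {..<r}" for v
  \<comment> \<open>Uniqueness of quotient and remainder makes the coding of position and letter
    injective.\<close>
  have dec: "i = j \<and> y = z" if "i * q + y = j * q + z" "y < q" "z < q" for i j y z
  proof -
    have "(i * q + y) div q = i" "(i * q + y) mod q = y" "(j * q + z) div q = j" "(j * q + z) mod q = z"
      using that(2,3) by auto
    with that(1) show ?thesis by metis
  qed
  have cS: "card (S u \<inter> S v) = card (agree r (h u) (h v))" if "u \<in> V" "v \<in> V" for u v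
  proof -
    have "S u \<inter> S v = (\<lambda>i. i * q + h u i) ` agree r (h u) (h v)"
    proof (intro equalityI subsetI)
      fix t assume "t \<in> S u \<inter> S v"
      then obtain i j where ij: "i < r" "j < r" "t = i * q + h u i" "t = j * q + h v j"
        by (auto simp: S_def)
      then have "i = j \<and> h u i = h v j"
        using that by (intro dec hq) auto
      with ij show "t \<in> (\<lambda>i. i * q + h u i) ` agree r (h u) (h v)"
        by (intro image_eqI[of _ _ i]) (auto simp: agree_def)
    next
      fix t assume "t \<in> (\<lambda>i. i * q + h u i) ` agree r (h u) (h v)"
      then obtain i where "i < r" "h u i = h v i" "t = i * q + h u i"
        by (auto simp: agree_def)
      then show "t \<in> S u \<inter> S v"
        unfolding S_def by (intro IntI image_eqI[of _ _ i]) simp_all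
    qed
    moreover have "inj_on (\<lambda>i. i * q + h u i) (agree r (h u) (h v))"
    proof (rule inj_onI)
      fix i j assume "i \<in> agree r (h u) (h v)" "j \<in> agree r (h u) (h v)"
        and eq: "i * q + h u i = j * q + h u j"
      then have "i < r" "j < r" by (auto simp: agree_def)
      then have "h u i < q" "h u j < q" using hq[OF that(1)] by blast+
      with dec[OF eq] show "i = j" by blast
    qed
    ultimately show ?thesis by (simp add: card_image)
  qed
  have ST: "S v \<subseteq> {..<k}" if "v \<in> V" for v
  proof -
    have "i * q + h v i < k" if "i < r" for i
    proof -
      have "i * q + h v i < Suc i * q" using hq[OF \<open>v \<in> V\<close> that] by simp
      also have "\<dots> \<le> r * q" using that by (intro mult_le_mono1) simp
      finally show ?thesis using assms(1) by simp
    qed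
    then show ?thesis by (auto simp: S_def)
  qed
  show ?thesis
  proof
    \<comment> \<open>A word agrees with itself in all \<open>r\<close> positions.\<close>
    have "card (S v) = r" if "v \<in> V" for v
      using cS[OF that that] by (simp add: agree_def)
    then show "stars {..<k} V S r"
      using ST by unfold_locales (auto simp: V_def)
    show "card V = q ^ r" by (simp add: V_def)
    fix u g d assume ug: "u \<in> V" "g \<subseteq> V"
    have inj: "inj_on h g" using h ug(2) by (metis bij_betw_def inj_on_subset)
    have "(\<Sum>v\<in>g. real (card (S u \<inter> S v))) = (\<Sum>v\<in>g. real (card (agree r (h u) (h v))))"
      using ug cS by (intro sum.cong) auto
    also have "\<dots> = (\<Sum>f\<in>h ` g. real (card (agree r (h u) f)))"
      by (simp add: sum.reindex[OF inj])
    also have "\<dots> \<le> real d * card (h ` g) + (2 * real q) ^ r / real q ^ d"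
      using ug hW assms(2) by (intro sum_agree_le) auto
    finally show "(\<Sum>v\<in>g. real (card (S u \<inter> S v)))
        \<le> real d * card g + (2 * real q) ^ r / real q ^ d"
      by (simp add: card_image[OF inj])
  qed
qed

section \<open>Choice of parameters and the exponent of \<open>k\<close>\<close>

lemma exists_hard_graph:
  fixes q d k :: nat
  assumes "16 * d * q \<le> k" "q \<ge> 2" "d > 0" "\<epsilon> \<ge> 0" "40 * \<epsilon> * sqrt d < 1"
  obtains G :: "(nat, nat) wgraph" and T where
    "wf_wgraph G" "T \<subseteq> verts G" "card T = k" "quasi_bipartite G T"
    "\<And>H. contraction_sparsifier (1 + \<epsilon>) G T H \<Longrightarrow> real q ^ d < 2 * card (verts H) * (2 ^ 16) ^ d"
proof -
  obtain V S where st: "stars {..<k} V S (16 * d)" and cV: "card V = q ^ (16 * d)" and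
    code: "\<And>u g d'. u \<in> V \<Longrightarrow> g \<subseteq> V \<Longrightarrow> (\<Sum>v\<in>g. real (card (S u \<inter> S v)))
      \<le> real d' * card g + (2 * real q) ^ (16 * d) / real q ^ d'"
    using exists_star_code[OF assms(1,2)] by metis
  interpret stars "{..<k}" V S "16 * d" by (rule st)
  have "V \<noteq> {}" using cV assms(2) by auto
  show ?thesis
  proof (rule that[OF wf_G _ _ quasi_bipartite_G])
    fix H :: "(nat set, nat) wgraph"
    assume "contraction_sparsifier (1 + \<epsilon>) G {..<k} H"
    then have "real (card V) * d < 2 * card (verts H) * ((2 * real q) ^ (16 * d) / real q ^ d)"
      using assms \<open>V \<noteq> {}\<close> by (intro card_parts_gt code) auto
    \<comment> \<open>The number \<open>q ^ (16 * d)\<close> of stars cancels against the same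
      factor of \<open>B\<close>.\<close>
    also have "\<dots> = real q ^ (16 * d) * (2 * card (verts H) * (2 ^ 16) ^ d / real q ^ d)"
      by (simp add: power_mult_distrib power_mult)
    finally have "real q ^ (16 * d) * d
        < real q ^ (16 * d) * (2 * card (verts H) * (2 ^ 16) ^ d / real q ^ d)"
      by (simp add: cV)
    moreover have "real q ^ (16 * d) > 0" using assms(2) by simp
    ultimately have "d < 2 * card (verts H) * (2 ^ 16) ^ d / real q ^ d"
      by (simp only: mult_less_cancel_left_pos)
    moreover have "real d \<ge> 1" using assms(3) by simp
    ultimately have "1 < 2 * card (verts H) * (2 ^ 16) ^ d / real q ^ d" by linarith
    then show "real q ^ d < 2 * card (verts H) * (2 ^ 16) ^ d"
      using assms(2) by (simp add: field_simps)
  qed (auto simp: star_graph_def)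
qed

text \<open>\<open>P\<close> is at least about \<open>(q / 2 ^ 16) ^ d\<close>, with
  \<open>d\<close> of order \<open>x\<close> and \<open>q\<close> of order \<open>k / x\<close>. As
  \<open>q\<close> may stay bounded while \<open>k\<close> grows along with \<open>x\<close>, the
  exponent loses a logarithm, through \<open>ln k \<le> ln (exp 1 + x) * ln q\<close>.\<close>

lemma powr_bound:
  fixes q d k :: nat and x P :: real
  assumes x: "x \<ge> 2 ^ 36" "x \<le> k" and d: "d = nat \<lfloor>x / 2 ^ 36\<rfloor>" and q: "q = k div (16 * d)"
    and P: "real q ^ d < 2 * P * (2 ^ 16) ^ d"
  shows "k powr (x / 2 ^ 39 / ln (exp 1 + x)) \<le> P"
proof -
  define L where "L = ln (exp 1 + x)"
  have pos: "x > 0" "real k > 0" using x by auto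
  have "real d \<le> x / 2 ^ 36" "x / 2 ^ 36 < real d + 1"
    unfolding d using pos(1) by (simp_all add: of_nat_nat) linarith+
  moreover from this x(1) have "real d \<ge> 1" by (cases d) auto
  \<comment> \<open>Rounding costs at most a factor 2, since
    \<open>d + 1 \<le> 2 * d\<close>.\<close>
  ultimately have d': "2 ^ 36 * real d \<le> x" "x \<le> 2 ^ 37 * real d" "real d \<ge> 1"
    by auto
  have "real (2 ^ 32 * (16 * d)) \<le> real k" using d'(1) x(2) by simp
  then have "2 ^ 32 * (16 * d) \<le> k" by (simp only: of_nat_le_iff)
  moreover have "16 * d > 0" using d'(3) by simp
  ultimately have q32: "q \<ge> 2 ^ 32"
    unfolding q by (simp only: less_eq_div_iff_mult_less_eq)
  have "real q \<ge> real (2 ^ 32)" using q32 by (simp only: of_nat_le_iff)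
  then have q': "real q \<ge> 2 ^ 32" by simp
  have lnq: "ln (real q) \<ge> 32 * ln 2"
  proof -
    have "ln (2 ^ 32 :: real) \<le> ln (real q)" using q' by (subst ln_le_cancel_iff) auto
    then show ?thesis using ln_realpow[of "2::real" 32] by simp
  qed
  have "k < 16 * d * (q + 1)"
    unfolding q using \<open>16 * d > 0\<close> dividend_less_times_div[of "16 * d" k] by simp
  then have "real k < real (16 * d * (q + 1))" by (simp only: of_nat_less_iff)
  also have "\<dots> \<le> 2 ^ 36 * real d * (real q / 2 ^ 31)"
    using q' d'(3) by (simp add: field_simps)
  also have "\<dots> \<le> x * (real q / 2 ^ 31)"
    using d'(1) by (intro mult_right_mono) auto
  finally have kq: "2 ^ 31 * (real k / x) \<le> real q"
    using pos by (simp add: field_simps)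
  have A: "ln (real k / x) \<ge> 0" using x pos by simp
  have "1 + ln (real k / x) \<le> ln (2 ^ 31) + ln (real k / x)"
  proof -
    have "exp 1 \<le> (2 ^ 31 :: real)" by (rule order_trans[OF exp_le]) simp
    then have "ln (exp 1) \<le> ln (2 ^ 31 :: real)" by (subst ln_le_cancel_iff) auto
    then show ?thesis by simp
  qed
  also have "\<dots> = ln (2 ^ 31 * (real k / x))" using pos by (subst ln_mult) auto
  also have "\<dots> \<le> ln (real q)" using kq pos q' by (subst ln_le_cancel_iff) auto
  finally have lnq1: "1 + ln (real k / x) \<le> ln (real q)" .
  have L1: "L \<ge> 1"
  proof -
    have "ln (exp 1) \<le> L" unfolding L_def using pos by (subst ln_le_cancel_iff) (auto intro: add_pos_pos)
    then show ?thesis by simp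
  qed
  have Lx: "ln x \<le> L"
    unfolding L_def using pos by (subst ln_le_cancel_iff) (auto intro: add_pos_pos)
  \<comment> \<open>Split \<open>k\<close> into \<open>x\<close> and \<open>k / x\<close>. The first
    factor costs at most \<open>L\<close>, which the summand 1 gained in \<open>lnq1\<close>
    absorbs.\<close>
  have "ln (real k) = ln x + ln (real k / x)" using pos by (simp add: ln_div)
  also have "\<dots> \<le> L * (1 + ln (real k / x))"
  proof -
    have "1 * ln (real k / x) \<le> L * ln (real k / x)" using A L1 by (intro mult_right_mono)
    then show ?thesis using Lx by (simp add: algebra_simps)
  qed
  also have "\<dots> \<le> L * ln (real q)" using lnq1 L1 by (intro mult_left_mono) auto
  finally have lnk: "ln (real k) \<le> L * ln (real q)" .
  have "0 < real q ^ d" using q' by simp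
  then have pos': "0 < 2 * P * (2 ^ 16) ^ d" using P by (rule less_trans)
  then have P0: "P > 0" by (simp add: zero_less_mult_iff)
  have "ln (real q ^ d) \<le> ln (2 * P * (2 ^ 16) ^ d)"
    using \<open>0 < real q ^ d\<close> pos' P by (intro ln_mono less_imp_le[OF P])
  then have "d * ln (real q) \<le> ln 2 + ln P + d * (16 * ln 2)"
    using P0 q' ln_realpow[of "2::real" 16] by (simp add: ln_mult ln_realpow)
  moreover have "d * (32 * ln 2) \<le> d * ln (real q)"
    using lnq by (intro mult_left_mono) auto
  moreover have "1 * ln 2 \<le> d * ln (2 :: real)"
    using d'(3) by (intro mult_right_mono) auto
  moreover have "ln (2 :: real) > 0" by simp
  \<comment> \<open>The lost factor \<open>2 * (2 ^ 16) ^ d\<close> is at most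
    \<open>2 ^ (17 * d)\<close>. As \<open>q \<ge> 2 ^ 32\<close>, it uses up at most 17/32 of the
    exponent, so more than a quarter remains.\<close>
  ultimately have lnP: "d * ln (real q) / 4 \<le> ln P" by linarith
  have "x / 2 ^ 39 / L * ln (real k) \<le> x / 2 ^ 39 / L * (L * ln (real q))"
    using lnk pos L1 by (intro mult_left_mono) auto
  also have "\<dots> = x / 2 ^ 39 * ln (real q)" using L1 by simp
  also have "\<dots> \<le> d / 4 * ln (real q)"
    using d'(2) q' by (intro mult_right_mono) auto
  also have "\<dots> \<le> ln P" using lnP by simp
  finally have "exp (x / 2 ^ 39 / L * ln (real k)) \<le> exp (ln P)" by simp
  then show ?thesis using pos P0 by (simp add: powr_def L_def)
qed

lemma card_verts_sparsifier_ge: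
  assumes "finite (verts G)" "T \<subseteq> verts G" "contraction_sparsifier q G T H"
  shows "card T \<le> card (verts H)"
proof -
  obtain L where "contraction_partition G T L" "H = contract G L"
    using assms(3) unfolding contraction_sparsifier_def by (elim exE conjE) (rule that)
  then show ?thesis
    using card_contraction_partition_ge[OF assms(1,2)] by (simp add: contract_def)
qed

theorem theorem1p3:
  "\<exists>f \<in> tilde_Omega (\<lambda>x. x). \<forall>k::nat. \<forall>\<epsilon>::real. k \<ge> 1 \<and> \<epsilon> > 0 \<longrightarrow>
     (\<exists>(G :: (nat, nat) wgraph) T.
        wf_wgraph G \<and> T \<subseteq> verts G \<and> card T = k \<and> quasi_bipartite G T \<and>
        (\<forall>H. contraction_sparsifier (1 + \<epsilon>) G T H \<longrightarrow>
           real (card (verts H)) \<ge> real k powr f (inv_eps_capped k \<epsilon>)))"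
proof (intro bexI allI impI)
  \<comment> \<open>The constant combines \<open>2 ^ 36\<close> from \<open>d\<close>, 2 from
    rounding and 4 from the loss in \<open>powr_bound\<close>.\<close>
  define f :: "real \<Rightarrow> real" where "f x = x / 2 ^ 39 / ln (exp 1 + x)" for x
  show "f \<in> tilde_Omega (\<lambda>x. x)"
    unfolding tilde_Omega_def mem_Collect_eq
    by (rule exI[of _ "1 / 2 ^ 39"], intro conjI exI[of _ 1]) (auto simp: f_def)
  fix k :: nat and \<epsilon> :: real
  assume "k \<ge> 1 \<and> \<epsilon> > 0"
  then have k: "k \<ge> 1" and \<epsilon>: "\<epsilon> > 0" by auto
  define x where "x = inv_eps_capped k \<epsilon>"
  have x: "x > 0" "x \<le> k" "x \<le> 1 / \<epsilon>"
    using k \<epsilon> by (auto simp: x_def inv_eps_capped_def)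
  show "\<exists>(G :: (nat, nat) wgraph) T.
        wf_wgraph G \<and> T \<subseteq> verts G \<and> card T = k \<and> quasi_bipartite G T \<and>
        (\<forall>H. contraction_sparsifier (1 + \<epsilon>) G T H \<longrightarrow>
           real (card (verts H)) \<ge> real k powr f (inv_eps_capped k \<epsilon>))"
  proof (cases "x < 2 ^ 36")
    case True
    \<comment> \<open>Below the threshold the exponent is at most 1, and \<open>k\<close> isolated
      terminals already force \<open>k\<close> parts.\<close>
    interpret stars "{..<k}" "{}" "\<lambda>_. {}" 0 by unfold_locales auto
    have ln1: "ln (exp 1 + x) \<ge> 1"
    proof -
      have "ln (exp 1) \<le> ln (exp 1 + x)"
        using x(1) by (subst ln_le_cancel_iff) (auto intro: add_pos_pos)
      then show ?thesis by simp
    qed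
    have "f x \<le> x / 2 ^ 39 / 1"
      unfolding f_def using ln1 x(1) by (intro divide_left_mono) auto
    then have "f x \<le> 1" using True by simp
    then have f1: "real k powr f x \<le> real k"
      using powr_mono[of "f x" 1 "real k"] k by simp
    have VG: "verts G = {..<k}" by (simp add: star_graph_def)
    have "real (card (verts H)) \<ge> real k powr f x" if "contraction_sparsifier (1 + \<epsilon>) G {..<k} H" for H
      using card_verts_sparsifier_ge[OF _ _ that] f1 by (simp add: VG)
    with wf_G quasi_bipartite_G VG show ?thesis
      by (intro exI[of _ G] exI[of _ "{..<k}"]) (auto simp: x_def)
  next
    case False
    define d where "d = nat \<lfloor>x / 2 ^ 36\<rfloor>"
    define q where "q = k div (16 * d)"
    have dx: "real d \<le> x / 2 ^ 36" unfolding d_def using x(1) by (intro of_nat_floor) simp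
    have d1: "d \<ge> 1" unfolding d_def using False by (intro le_nat_floor) simp
    have "16 * d * q \<le> k" unfolding q_def by (rule times_div_less_eq_dividend)
    moreover have "q \<ge> 2"
    proof -
      have "real (2 * (16 * d)) \<le> real k" using dx x by simp
      then have "2 * (16 * d) \<le> k" by (simp only: of_nat_le_iff)
      then show ?thesis unfolding q_def using d1 by (simp add: less_eq_div_iff_mult_less_eq)
    qed
    moreover have "40 * \<epsilon> * sqrt d < 1"
    proof -
      \<comment> \<open>The crude bound \<open>sqrt d \<le> d\<close> suffices, because
        \<open>d \<le> 1 / \<epsilon> / 2 ^ 36\<close> and \<open>40 < 2 ^ 36\<close>.\<close>
      have "real d \<le> (real d)\<^sup>2" using d1 by (simp add: power2_eq_square)
      then have "sqrt d \<le> d" by (intro real_le_lsqrt) auto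
      then have "40 * \<epsilon> * sqrt d \<le> 40 * \<epsilon> * (x / 2 ^ 36)"
        using dx \<epsilon> by (intro mult_left_mono) auto
      also have "\<dots> \<le> 40 * \<epsilon> * (1 / \<epsilon> / 2 ^ 36)"
        using x(3) \<epsilon> by (intro mult_left_mono divide_right_mono) auto
      also have "\<dots> < 1" using \<epsilon> by simp
      finally show ?thesis .
    qed
    ultimately obtain G :: "(nat, nat) wgraph" and T where
      G: "wf_wgraph G" "T \<subseteq> verts G" "card T = k" "quasi_bipartite G T" and
      big: "\<And>H. contraction_sparsifier (1 + \<epsilon>) G T H \<Longrightarrow>
        real q ^ d < 2 * card (verts H) * (2 ^ 16) ^ d"
      using d1 \<epsilon> by (elim exists_hard_graph[of d q k \<epsilon>]) auto
    have "real k powr f x \<le> real (card (verts H))" if "contraction_sparsifier (1 + \<epsilon>) G T H" for H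
      unfolding f_def using big[OF that] False x(2)
      by (intro powr_bound[where d = d and q = q]) (auto simp: d_def q_def)
    with G show ?thesis
      by (intro exI[of _ G] exI[of _ T]) (auto simp: x_def)
  qed
qed

end
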